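(* Let $G$ be a finite group such that $G=AH$, where $A$ is an abelian normal subgroup of $G$ and $H$ is an IYB subgroup of $G$. Suppose that there is a bijective 1-cocycle $\pi:H\to B$, with respect to an action of $H$ on an abelian group $B$, such that $H\cap A$ acts trivially on $B$. Then $G$ is an IYB group. In particular, every semidirect product $A\rtimes H$ of a finite abelian group $A$ by an IYB group $H$ is an IYB group.
   Context: $\mathrm{Fa}_n$ is the free abelian group (written multiplicatively) with basis $u_1,\dots,u_n$, and $\mathrm{Fa}_n\rtimes \mathrm{Sym}_n$ is the semidirect product for the natural action $\sigma(u_i)=u_{\sigma(i)}$, where $\mathrm{Sym}_n$ is the symmetric group of degree $n$. A finite group $G$ is an involutive Yang-Baxter (IYB) group if for some positive integer $n$ there is a map $\phi:\mathrm{Fa}_n\to \mathrm{Sym}_n$ such that $\{(a,\phi(a)) : a\in \mathrm{Fa}_n\}$ is a subgroup of $\mathrm{Fa}_n\rtimes \mathrm{Sym}_n$ and $G\cong\phi(\mathrm{Fa}_n)$. All actions of a group $H$ on an abelian group $B$ are by automorphisms of $B$; abelian groups are written multiplicatively. A bijective 1-cocycle $\pi:H\to B$ with respect to such an action is a bijective map with $\pi(gh)=\pi(g)\,g(\pi(h))$ for all $g,h\in H$. *)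

theory Defs
  imports "HOL-Algebra.Algebra" "HOL-Algebra.Sym_Groups" "HOL-Algebra.Free_Abelian_Groups"
begin

text \<open>
  Groups are written as in HOL-Algebra. An action of \<open>K\<close> on \<open>N\<close> by automorphisms is
  a homomorphism \<open>\<alpha> \<in> hom K (AutoGroup N)\<close>; \<open>\<alpha> k x\<close> is the result of acting with \<open>k\<close> on \<open>x\<close>.
\<close>

definition semidirect_product ::
    "('a, 'x) monoid_scheme \<Rightarrow> ('b, 'y) monoid_scheme \<Rightarrow> ('b \<Rightarrow> 'a \<Rightarrow> 'a) \<Rightarrow> ('a \<times> 'b) monoid"
  where "semidirect_product N K \<alpha> =
    \<lparr>carrier = carrier N \<times> carrier K,
     monoid.mult = (\<lambda>(a, g) (b, h). (a \<otimes>\<^bsub>N\<^esub> \<alpha> g b, g \<otimes>\<^bsub>K\<^esub> h)),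
     one = (\<one>\<^bsub>N\<^esub>, \<one>\<^bsub>K\<^esub>)\<rparr>"

lemma group_semidirect_product:
  assumes "group N" "group K" "\<alpha> \<in> hom K (AutoGroup N)"
  shows "group (semidirect_product N K \<alpha>)"
proof -
  interpret N: group N by fact
  interpret K: group K by fact
  interpret \<alpha>: group_hom K "AutoGroup N" \<alpha>
    using assms N.AutoGroup by (simp add: group_hom_def group_hom_axioms_def)
  have aut: "\<alpha> g \<in> hom N N" "\<alpha> g \<in> Bij (carrier N)" if "g \<in> carrier K" for g
    using \<alpha>.hom_closed[OF that] by (auto simp: AutoGroup_def auto_def)
  have cl: "\<alpha> g x \<in> carrier N" if "g \<in> carrier K" "x \<in> carrier N" for g x
    using aut[OF that(1)] that(2) by (auto simp: hom_def)
  have mul: "\<alpha> g (x \<otimes>\<^bsub>N\<^esub> y) = \<alpha> g x \<otimes>\<^bsub>N\<^esub> \<alpha> g y"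
    if "g \<in> carrier K" "x \<in> carrier N" "y \<in> carrier N" for g x y
    using aut[OF that(1)] that by (auto simp: hom_def)
  have comp: "\<alpha> (g \<otimes>\<^bsub>K\<^esub> h) x = \<alpha> g (\<alpha> h x)"
    if "g \<in> carrier K" "h \<in> carrier K" "x \<in> carrier N" for g h x
    using \<alpha>.hom_mult[OF that(1,2)] aut[OF that(1)] aut[OF that(2)] that(3)
    by (simp add: AutoGroup_def BijGroup_def compose_def)
  have one: "\<alpha> \<one>\<^bsub>K\<^esub> x = x" if "x \<in> carrier N" for x
    using \<alpha>.hom_one that by (simp add: AutoGroup_def BijGroup_def)
  show ?thesis
  proof (rule groupI)
    fix x assume "x \<in> carrier (semidirect_product N K \<alpha>)"
    then obtain a g where x: "x = (a, g)" "a \<in> carrier N" "g \<in> carrier K"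
      by (auto simp: semidirect_product_def)
    let ?y = "(\<alpha> (inv\<^bsub>K\<^esub> g) (inv\<^bsub>N\<^esub> a), inv\<^bsub>K\<^esub> g)"
    have "\<alpha> (inv\<^bsub>K\<^esub> g) \<one>\<^bsub>N\<^esub> = \<one>\<^bsub>N\<^esub>"
      using x aut(1)[of "inv\<^bsub>K\<^esub> g"] hom_one[of _ N N] N.is_group by blast
    then have "\<alpha> (inv\<^bsub>K\<^esub> g) (inv\<^bsub>N\<^esub> a) \<otimes>\<^bsub>N\<^esub> \<alpha> (inv\<^bsub>K\<^esub> g) a = \<one>\<^bsub>N\<^esub>"
      using x mul[of "inv\<^bsub>K\<^esub> g" "inv\<^bsub>N\<^esub> a" a] by simp
    then have "?y \<otimes>\<^bsub>semidirect_product N K \<alpha>\<^esub> x = \<one>\<^bsub>semidirect_product N K \<alpha>\<^esub>"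
      using x by (simp add: semidirect_product_def del: \<alpha>.hom_inv)
    moreover have "?y \<in> carrier (semidirect_product N K \<alpha>)"
      using x by (simp add: semidirect_product_def cl del: \<alpha>.hom_inv)
    ultimately show "\<exists>y\<in>carrier (semidirect_product N K \<alpha>).
        y \<otimes>\<^bsub>semidirect_product N K \<alpha>\<^esub> x = \<one>\<^bsub>semidirect_product N K \<alpha>\<^esub>" ..
  qed (auto simp: semidirect_product_def cl mul comp one N.m_assoc K.m_assoc
      simp del: \<alpha>.hom_mult \<alpha>.hom_one)
qed

text \<open>
  \<open>Fa\<^sub>n\<close> is \<open>free_Abelian_group {1..n}\<close> with basis \<open>u\<^sub>i = frag_of i\<close>; the library writes its
  multiplication as addition of finitely supported integer-valued functions. The
  restriction to the carrier makes the natural action land in \<open>AutoGroup\<close>, whose elements are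
  extensional functions.
\<close>

definition perm_action :: "nat \<Rightarrow> (nat \<Rightarrow> nat) \<Rightarrow> (nat \<Rightarrow>\<^sub>0 int) \<Rightarrow> (nat \<Rightarrow>\<^sub>0 int)"
  where "perm_action n \<sigma> =
    restrict (frag_extend (\<lambda>i. frag_of (\<sigma> i))) (carrier (free_Abelian_group {1..n}))"

lemma perm_action_basis:
  "i \<in> {1..n} \<Longrightarrow> perm_action n \<sigma> (frag_of i) = frag_of (\<sigma> i)"
  by (simp add: perm_action_def)

lemma perm_action_hom:
  "perm_action n \<in> hom (sym_group n) (AutoGroup (free_Abelian_group {1..n}))"
proof -
  let ?F = "free_Abelian_group {1..n}"
  let ?C = "carrier ?F"
  let ?e = "\<lambda>\<sigma>::nat \<Rightarrow> nat. frag_extend (\<lambda>i. frag_of (\<sigma> i))"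
  have cl: "?e \<sigma> x \<in> ?C" if s: "\<sigma> permutes {1..n}" and x: "x \<in> ?C" for \<sigma> x
  proof -
    have "Poly_Mapping.keys (?e \<sigma> x) \<subseteq> \<sigma> ` Poly_Mapping.keys x"
      using keys_frag_extend[of "\<lambda>i. frag_of (\<sigma> i)" x] by auto
    also have "\<dots> \<subseteq> \<sigma> ` {1..n}"
      using x by (intro image_mono) (simp add: free_Abelian_group_def)
    also have "\<sigma> ` {1..n} = {1..n}"
      using s by (rule permutes_image)
    finally show ?thesis
      by (simp add: free_Abelian_group_def)
  qed
  have comp: "?e \<sigma> (?e \<tau> x) = ?e (\<sigma> \<circ> \<tau>) x" for \<sigma> \<tau> x
    using frag_extend_compose[of "\<lambda>i. frag_of (\<sigma> i)" \<tau> x] by (simp add: comp_def)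
  have ident: "?e id x = x" for x
    by (simp add: id_def flip: frag_expansion)
  have bij: "bij_betw (?e \<sigma>) ?C ?C" if s: "\<sigma> permutes {1..n}" for \<sigma>
  proof (rule bij_betw_byWitness[where f' = "?e (inv_into UNIV \<sigma>)"])
    show "\<forall>x\<in>?C. ?e (inv_into UNIV \<sigma>) (?e \<sigma> x) = x" "\<forall>x\<in>?C. ?e \<sigma> (?e (inv_into UNIV \<sigma>) x) = x"
      by (auto simp only: comp permutes_inv_o[OF s] ident)
    show "?e \<sigma> ` ?C \<subseteq> ?C" "?e (inv_into UNIV \<sigma>) ` ?C \<subseteq> ?C"
      using cl[OF s] cl[OF permutes_inv[OF s]] by blast+
  qed
  have aut: "perm_action n \<sigma> \<in> auto ?F" if s: "\<sigma> permutes {1..n}" for \<sigma>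
  proof -
    have "perm_action n \<sigma> \<in> hom ?F ?F"
      using cl[OF s] monoid.m_closed[OF group.is_monoid[OF group_free_Abelian_group], of _ "{1..n}"]
      by (auto simp: hom_def perm_action_def frag_extend_add)
    moreover have "bij_betw (perm_action n \<sigma>) ?C ?C"
      using bij[OF s] by (rule bij_betw_cong[THEN iffD1, rotated]) (simp only: perm_action_def restrict_apply')
    then have "perm_action n \<sigma> \<in> Bij ?C"
      by (simp add: Bij_def perm_action_def)
    ultimately show ?thesis by (simp add: auto_def)
  qed
  show ?thesis
  proof (rule homI)
    fix \<sigma> \<tau> assume "\<sigma> \<in> carrier (sym_group n)" "\<tau> \<in> carrier (sym_group n)"
    then have s: "\<sigma> permutes {1..n}" "\<tau> permutes {1..n}"
      by (simp_all add: sym_group_def)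
    then have "perm_action n \<sigma> \<in> Bij ?C" "perm_action n \<tau> \<in> Bij ?C"
      using aut by (auto simp: auto_def)
    then show "perm_action n (\<sigma> \<otimes>\<^bsub>sym_group n\<^esub> \<tau>) =
        perm_action n \<sigma> \<otimes>\<^bsub>AutoGroup ?F\<^esub> perm_action n \<tau>"
      using cl[OF s(2)]
      by (auto simp: AutoGroup_def BijGroup_def compose_def sym_group_def perm_action_def
          comp restrict_def fun_eq_iff comp_def)
  qed (use aut in \<open>simp add: AutoGroup_def sym_group_def\<close>)
qed

definition IYB_group :: "('a, 'x) monoid_scheme \<Rightarrow> bool"
  where "IYB_group G \<longleftrightarrow> group G \<and> finite (carrier G) \<and>
    (\<exists>n>0. \<exists>\<phi> \<in> carrier (free_Abelian_group {1..n}) \<rightarrow> carrier (sym_group n).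
       subgroup {(a, \<phi> a) | a. a \<in> carrier (free_Abelian_group {1..n})}
         (semidirect_product (free_Abelian_group {1..n}) (sym_group n) (perm_action n)) \<and>
       G \<cong> (sym_group n)\<lparr>carrier := \<phi> ` carrier (free_Abelian_group {1..n})\<rparr>)"

definition bijective_1_cocycle ::
    "('h, 'x) monoid_scheme \<Rightarrow> ('b, 'y) monoid_scheme \<Rightarrow> ('h \<Rightarrow> 'b \<Rightarrow> 'b) \<Rightarrow> ('h \<Rightarrow> 'b) \<Rightarrow> bool"
  where "bijective_1_cocycle H B \<alpha> \<pi> \<longleftrightarrow>
    bij_betw \<pi> (carrier H) (carrier B) \<and>
    (\<forall>g\<in>carrier H. \<forall>h\<in>carrier H. \<pi> (g \<otimes>\<^bsub>H\<^esub> h) = \<pi> g \<otimes>\<^bsub>B\<^esub> \<alpha> g (\<pi> h))"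

end

theory Submission
  imports Defs
begin

text \<open>
  A bijective 1-cocycle \<open>\<pi> : G \<rightarrow> C\<close> is best read backwards: its inverse \<open>\<tau> : C \<rightarrow> G\<close> satisfies
  \<open>\<tau> (c \<cdot> \<tau>(c)(d)) = \<tau>(c) \<tau>(d)\<close>, which is precisely the condition that the graph of \<open>\<tau>\<close> be closed
  under the multiplication of \<open>C \<rtimes> G\<close>. The definition of an IYB group asks for a map of the same
  kind on \<open>Fa\<^sub>n\<close>, only not injective. So the proof works throughout with surjections
  \<open>\<tau>\<close> from an abelian \<open>G\<close>-group \<open>C\<close>, generated by a finite \<open>G\<close>-stable set, that satisfy this
  identity (the locale \<open>cocycle_cover\<close>). They contain the bijective cocycles and the
  maps \<open>Fa\<^sub>n \<rightarrow> Sym\<^sub>n\<close> as special cases, and no quotient of \<open>C\<close> ever has to be formed.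

  A finite group with such a cover is IYB (\<open>IYB_group_of_cover\<close>). If \<open>S\<close> is the stable generating
  set, \<open>G\<close> acts faithfully on the finite set \<open>S \<times> G\<close>, and the projection to \<open>S\<close> is equivariant. It
  extends to an equivariant surjection from the free abelian group on \<open>S \<times> G\<close> onto \<open>C\<close>; its
  composite with \<open>\<tau>\<close> and with the permutation representation on \<open>S \<times> G\<close> is the required \<open>\<phi>\<close>.

  Covers are inherited in two ways. If \<open>C\<close> covers \<open>H\<close> and \<open>H\<close> acts on a finite abelian group \<open>N\<close>,
  then \<open>N \<times> C\<close> covers \<open>N \<rtimes> H\<close> via \<open>(x, c) \<mapsto> (x, \<tau>(c))\<close> (\<open>cocycle_cover_semidirect_product\<close>). If
  \<open>C\<close> covers \<open>P\<close> and \<open>\<theta> : P \<rightarrow> G\<close> is a surjective homomorphism whose kernel acts trivially on \<open>C\<close>,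
  then \<open>C\<close> covers \<open>G\<close> via \<open>\<theta> \<circ> \<tau>\<close> (\<open>cocycle_cover_quotient\<close>).

  The first of these alone settles semidirect products. For \<open>G = AH\<close>, it is applied to \<open>A \<rtimes> H\<close> with the
  conjugation action, and the second to \<open>\<theta>(a, h) = ah\<close>. The kernel of \<open>\<theta>\<close> consists of the pairs
  \<open>(h\<inverse>, h)\<close> with \<open>h \<in> A \<inter> H\<close>. Such a pair acts on \<open>A \<times> B\<close> as \<open>h\<close> does: trivially on \<open>A\<close>, because \<open>A\<close>
  is abelian, and trivially on \<open>B\<close>, by hypothesis.
\<close>

section \<open>Actions by automorphisms\<close>

text \<open>
  An action is kept here as a plain function with the identities that hold on the carriers; unlike
  elements of \<open>AutoGroup C\<close>, the maps \<open>\<alpha> g\<close> need not be extensional. So actions can be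
  written down by formulas such as conjugation, and converted when \<open>AutoGroup\<close> is wanted.
\<close>

locale automorphism_action =
  G: group G + C: comm_group C
  for G :: "('g, 'x) monoid_scheme" and C :: "('c, 'y) monoid_scheme" +
  fixes \<alpha> :: "'g \<Rightarrow> 'c \<Rightarrow> 'c"
  assumes act_closed: "\<lbrakk>g \<in> carrier G; c \<in> carrier C\<rbrakk> \<Longrightarrow> \<alpha> g c \<in> carrier C"
    and act_mult: "\<lbrakk>g \<in> carrier G; c \<in> carrier C; d \<in> carrier C\<rbrakk>
      \<Longrightarrow> \<alpha> g (c \<otimes>\<^bsub>C\<^esub> d) = \<alpha> g c \<otimes>\<^bsub>C\<^esub> \<alpha> g d"
    and act_comp: "\<lbrakk>g \<in> carrier G; h \<in> carrier G; c \<in> carrier C\<rbrakk>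
      \<Longrightarrow> \<alpha> (g \<otimes>\<^bsub>G\<^esub> h) c = \<alpha> g (\<alpha> h c)"
    and act_one: "c \<in> carrier C \<Longrightarrow> \<alpha> \<one>\<^bsub>G\<^esub> c = c"
begin

lemma act_hom: "g \<in> carrier G \<Longrightarrow> \<alpha> g \<in> hom C C"
  by (simp add: hom_def act_closed act_mult)

lemma act_unit: "g \<in> carrier G \<Longrightarrow> \<alpha> g \<one>\<^bsub>C\<^esub> = \<one>\<^bsub>C\<^esub>"
  using hom_one[OF act_hom C.is_group C.is_group] .

lemma act_inv_cancel:
  assumes "g \<in> carrier G" "c \<in> carrier C"
  shows "\<alpha> g (\<alpha> (inv\<^bsub>G\<^esub> g) c) = c" "\<alpha> (inv\<^bsub>G\<^esub> g) (\<alpha> g c) = c"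
  using assms act_comp[of g "inv\<^bsub>G\<^esub> g" c] act_comp[of "inv\<^bsub>G\<^esub> g" g c]
  by (simp_all add: act_one)

lemma restrict_act_hom_AutoGroup:
  "(\<lambda>g. restrict (\<alpha> g) (carrier C)) \<in> hom G (AutoGroup C)"
proof -
  have bij: "restrict (\<alpha> g) (carrier C) \<in> Bij (carrier C)" if g: "g \<in> carrier G" for g
  proof -
    have "bij_betw (\<alpha> g) (carrier C) (carrier C)"
      using g act_inv_cancel[OF g]
      by (intro bij_betw_byWitness[where f' = "\<alpha> (inv\<^bsub>G\<^esub> g)"]) (auto simp: act_closed)
    then show ?thesis by (simp add: Bij_def)
  qed
  show ?thesis
  proof (rule homI)
    fix g assume "g \<in> carrier G"
    then show "restrict (\<alpha> g) (carrier C) \<in> carrier (AutoGroup C)"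
      using bij by (simp add: AutoGroup_def auto_def hom_def act_closed act_mult)
  next
    fix g h assume "g \<in> carrier G" "h \<in> carrier G"
    then show "restrict (\<alpha> (g \<otimes>\<^bsub>G\<^esub> h)) (carrier C) =
        restrict (\<alpha> g) (carrier C) \<otimes>\<^bsub>AutoGroup C\<^esub> restrict (\<alpha> h) (carrier C)"
      using bij by (auto simp: AutoGroup_def BijGroup_def compose_def act_comp act_closed fun_eq_iff)
  qed
qed

end

lemma automorphism_action_of_hom:
  assumes "group G" "comm_group C" and \<alpha>: "\<alpha> \<in> hom G (AutoGroup C)"
  shows "automorphism_action G C \<alpha>"
proof -
  interpret G: group G by fact
  interpret C: comm_group C by fact
  interpret \<alpha>: group_hom G "AutoGroup C" \<alpha>
    using \<alpha> C.AutoGroup by (simp add: group_hom_def group_hom_axioms_def)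
  have aut: "\<alpha> g \<in> hom C C" "\<alpha> g \<in> Bij (carrier C)" if "g \<in> carrier G" for g
    using \<alpha>.hom_closed[OF that] by (auto simp: AutoGroup_def auto_def)
  show ?thesis
  proof
    show "\<alpha> (g \<otimes>\<^bsub>G\<^esub> h) c = \<alpha> g (\<alpha> h c)"
      if "g \<in> carrier G" "h \<in> carrier G" "c \<in> carrier C" for g h c
      using \<alpha>.hom_mult[OF that(1,2)] aut[OF that(1)] aut[OF that(2)] that(3)
      by (simp add: AutoGroup_def BijGroup_def compose_def)
    show "\<alpha> \<one>\<^bsub>G\<^esub> c = c" if "c \<in> carrier C" for c
      using \<alpha>.hom_one that by (simp add: AutoGroup_def BijGroup_def)
  qed (use aut(1) in \<open>auto simp: hom_def\<close>)
qed

lemma automorphism_action_perm_action: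
  "automorphism_action (sym_group n) (free_Abelian_group {1..n}) (perm_action n)"
  by (intro automorphism_action_of_hom sym_group_is_group abelian_free_Abelian_group perm_action_hom)

section \<open>Cocycle covers\<close>

text \<open>
  The map \<open>\<tau>\<close> generalises the inverse of a bijective 1-cocycle by dropping injectivity, which makes
  room for the infinite group \<open>C = Fa\<^sub>n\<close>. The set \<open>S\<close> is the substitute for finiteness of \<open>C\<close>: it is
  the finite \<open>G\<close>-set from which permutations are built. Having \<open>\<one>\<close> in \<open>S\<close> ensures that \<open>S\<close> is not
  empty, so that the degree \<open>n\<close> is positive, and that \<open>N \<times> S\<close> contains \<open>N \<times> {\<one>}\<close> and hence
  generates \<open>N \<times> C\<close>. That \<open>S\<close> generates \<open>C\<close> is expressed through
  subgroups, the form in which it is applied to images and preimages of homomorphisms.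
\<close>

locale cocycle_cover = automorphism_action G C \<alpha>
  for G :: "('g, 'x) monoid_scheme" and C :: "('c, 'y) monoid_scheme" and \<alpha> +
  fixes \<tau> :: "'c \<Rightarrow> 'g" and S :: "'c set"
  assumes cover_closed: "c \<in> carrier C \<Longrightarrow> \<tau> c \<in> carrier G"
    and cover_surj: "g \<in> carrier G \<Longrightarrow> \<exists>c\<in>carrier C. \<tau> c = g"
    and cover_cocycle: "\<lbrakk>c \<in> carrier C; d \<in> carrier C\<rbrakk>
      \<Longrightarrow> \<tau> (c \<otimes>\<^bsub>C\<^esub> \<alpha> (\<tau> c) d) = \<tau> c \<otimes>\<^bsub>G\<^esub> \<tau> d"
    and gens_finite: "finite S"
    and gens_carrier: "S \<subseteq> carrier C"
    and gens_one: "\<one>\<^bsub>C\<^esub> \<in> S"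
    and gens_stable: "\<lbrakk>g \<in> carrier G; s \<in> S\<rbrakk> \<Longrightarrow> \<alpha> g s \<in> S"
    and gens_generate: "\<lbrakk>subgroup U C; S \<subseteq> U\<rbrakk> \<Longrightarrow> carrier C \<subseteq> U"

text \<open>
  Putting \<open>c = d = \<one>\<close> in the cocycle identity shows that \<open>\<tau> \<one>\<close> is idempotent.
\<close>

lemma (in cocycle_cover) cover_one: "\<tau> \<one>\<^bsub>C\<^esub> = \<one>\<^bsub>G\<^esub>"
proof -
  have "\<tau> \<one>\<^bsub>C\<^esub> \<in> carrier G" by (simp add: cover_closed)
  then show ?thesis
    using cover_cocycle[of "\<one>\<^bsub>C\<^esub>" "\<one>\<^bsub>C\<^esub>"] by (simp add: act_unit)
qed

lemma cocycle_cover_of_bijective_1_cocycle: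
  assumes "group H" "finite (carrier H)" "comm_group B" "\<alpha> \<in> hom H (AutoGroup B)"
    and \<pi>: "bijective_1_cocycle H B \<alpha> \<pi>"
  shows "cocycle_cover H B \<alpha> (inv_into (carrier H) \<pi>) (carrier B)"
proof -
  interpret automorphism_action H B \<alpha>
    by (rule automorphism_action_of_hom) fact+
  let ?\<tau> = "inv_into (carrier H) \<pi>"
  have bij: "bij_betw \<pi> (carrier H) (carrier B)"
    and cocycle: "\<And>g h. \<lbrakk>g \<in> carrier H; h \<in> carrier H\<rbrakk> \<Longrightarrow> \<pi> (g \<otimes>\<^bsub>H\<^esub> h) = \<pi> g \<otimes>\<^bsub>B\<^esub> \<alpha> g (\<pi> h)"
    using \<pi> by (auto simp: bijective_1_cocycle_def)
  have closed: "?\<tau> b \<in> carrier H" if "b \<in> carrier B" for b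
    using bij_betwE[OF bij_betw_inv_into[OF bij]] that by blast
  show ?thesis
  proof
    show "\<exists>b\<in>carrier B. ?\<tau> b = h" if "h \<in> carrier H" for h
      using that bij_betwE[OF bij] bij_betw_inv_into_left[OF bij] by blast
    show "?\<tau> (b \<otimes>\<^bsub>B\<^esub> \<alpha> (?\<tau> b) c) = ?\<tau> b \<otimes>\<^bsub>H\<^esub> ?\<tau> c" if "b \<in> carrier B" "c \<in> carrier B" for b c
      using that closed cocycle[of "?\<tau> b" "?\<tau> c"] bij_betw_inv_into_left[OF bij, of "?\<tau> b \<otimes>\<^bsub>H\<^esub> ?\<tau> c"]
      by (simp add: bij_betw_inv_into_right[OF bij])
    show "finite (carrier B)"
      using assms(2) bij_betw_finite[OF bij] by blast
  qed (auto simp: closed act_closed)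
qed

lemma subgroup_free_Abelian_group_eq:
  assumes U: "subgroup U (free_Abelian_group \<Omega>)" and gens: "frag_of ` \<Omega> \<subseteq> U"
  shows "carrier (free_Abelian_group \<Omega>) \<subseteq> U"
proof
  fix a assume "a \<in> carrier (free_Abelian_group \<Omega>)"
  then have "Poly_Mapping.keys a \<subseteq> \<Omega>" by simp
  then show "a \<in> U"
  proof (induction rule: frag_induction)
    case zero
    then show ?case using subgroup.one_closed[OF U] by simp
  next
    case (one x)
    then show ?case using gens by auto
  next
    case (diff a b)
    have "Poly_Mapping.keys b \<subseteq> \<Omega>"
      using subgroup.mem_carrier[OF U diff(2)] by simp
    then show ?case
      using subgroup.m_closed[OF U diff(1) subgroup.m_inv_closed[OF U diff(2)]] by simp
  qed
qed

text \<open>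
  The map \<open>\<phi>\<close> in the definition of an IYB group is itself a cover: closure of its graph under
  multiplication is the cocycle identity, and the basis together with the unit is a finite stable
  generating set. It only has to be carried along the isomorphism \<open>\<kappa>\<close> from \<open>K\<close> to the image of \<open>\<phi>\<close>.
\<close>

lemma IYB_group_obtains_cocycle_cover:
  assumes "IYB_group K"
  obtains n and \<alpha> :: "'k \<Rightarrow> _" and \<tau> and S
  where "cocycle_cover (K :: ('k, 'x) monoid_scheme) (free_Abelian_group {1..n::nat}) \<alpha> \<tau> S"
proof -
  from assms obtain n \<phi> where "group K" and n: "n > 0"
    and \<phi>: "\<phi> \<in> carrier (free_Abelian_group {1..n}) \<rightarrow> carrier (sym_group n)"
    and graph: "subgroup {(a, \<phi> a) | a. a \<in> carrier (free_Abelian_group {1..n})}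
         (semidirect_product (free_Abelian_group {1..n}) (sym_group n) (perm_action n))"
      (is "subgroup ?\<Gamma> ?P")
    and "K \<cong> (sym_group n)\<lparr>carrier := \<phi> ` carrier (free_Abelian_group {1..n})\<rparr>"
    unfolding IYB_group_def by blast
  then obtain \<kappa>
    where \<kappa>: "\<kappa> \<in> iso K ((sym_group n)\<lparr>carrier := \<phi> ` carrier (free_Abelian_group {1..n})\<rparr>)"
    unfolding is_iso_def by blast
  let ?F = "free_Abelian_group {1..n}"
  interpret K: group K by fact
  interpret perm: automorphism_action "sym_group n" ?F "perm_action n"
    by (rule automorphism_action_perm_action)
  have bij: "bij_betw \<kappa> (carrier K) (\<phi> ` carrier ?F)"
    and \<kappa>_mult: "\<And>g h. \<lbrakk>g \<in> carrier K; h \<in> carrier K\<rbrakk> \<Longrightarrow> \<kappa> (g \<otimes>\<^bsub>K\<^esub> h) = \<kappa> g \<otimes>\<^bsub>sym_group n\<^esub> \<kappa> h"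
    using \<kappa> by (auto simp: iso_def hom_def)
  have \<kappa>_closed: "\<kappa> g \<in> carrier (sym_group n)" if "g \<in> carrier K" for g
    using that bij_betwE[OF bij] \<phi> by fastforce
  have "\<kappa> \<in> hom K (sym_group n)"
    by (simp add: hom_def \<kappa>_closed \<kappa>_mult)
  then have \<kappa>_one: "\<kappa> \<one>\<^bsub>K\<^esub> = \<one>\<^bsub>sym_group n\<^esub>"
    using hom_one K.is_group sym_group_is_group by blast
  define \<tau> where "\<tau> a = inv_into (carrier K) \<kappa> (\<phi> a)" for a
  have \<tau>_closed: "\<tau> a \<in> carrier K" and \<kappa>_\<tau>: "\<kappa> (\<tau> a) = \<phi> a" if "a \<in> carrier ?F" for a
    using that bij_betwE[OF bij_betw_inv_into[OF bij]] bij_betw_inv_into_right[OF bij]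
    by (auto simp: \<tau>_def)
  have \<phi>_cocycle: "\<phi> (a + perm_action n (\<phi> a) b) = \<phi> a \<otimes>\<^bsub>sym_group n\<^esub> \<phi> b"
    if "a \<in> carrier ?F" "b \<in> carrier ?F" for a b
  proof -
    have "(a, \<phi> a) \<otimes>\<^bsub>?P\<^esub> (b, \<phi> b) \<in> ?\<Gamma>"
      using that by (intro subgroup.m_closed[OF graph]) auto
    then show ?thesis by (auto simp: semidirect_product_def)
  qed
  have "cocycle_cover K ?F (\<lambda>g. perm_action n (\<kappa> g)) \<tau> (insert 0 (frag_of ` {1..n}))"
  proof
    show "perm_action n (\<kappa> g) c \<in> carrier ?F" if "g \<in> carrier K" "c \<in> carrier ?F" for g c
      using that perm.act_closed \<kappa>_closed by blast
    show "perm_action n (\<kappa> g) (c \<otimes>\<^bsub>?F\<^esub> d) =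
        perm_action n (\<kappa> g) c \<otimes>\<^bsub>?F\<^esub> perm_action n (\<kappa> g) d"
      if "g \<in> carrier K" "c \<in> carrier ?F" "d \<in> carrier ?F" for g c d
      using that perm.act_mult \<kappa>_closed by blast
    show "perm_action n (\<kappa> (g \<otimes>\<^bsub>K\<^esub> h)) c = perm_action n (\<kappa> g) (perm_action n (\<kappa> h) c)"
      if "g \<in> carrier K" "h \<in> carrier K" "c \<in> carrier ?F" for g h c
      using that perm.act_comp \<kappa>_closed \<kappa>_mult by metis
    show "perm_action n (\<kappa> \<one>\<^bsub>K\<^esub>) c = c" if "c \<in> carrier ?F" for c
      using that perm.act_one \<kappa>_one by metis
    show "\<tau> a \<in> carrier K" if "a \<in> carrier ?F" for a
      using that by (rule \<tau>_closed)
    show "\<exists>a\<in>carrier ?F. \<tau> a = g" if g: "g \<in> carrier K" for g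
    proof -
      have "\<kappa> g \<in> \<phi> ` carrier ?F"
        using bij_betwE[OF bij] g by (rule bspec)
      then obtain a where "a \<in> carrier ?F" "\<phi> a = \<kappa> g"
        by auto
      then show ?thesis
        using bij_betw_inv_into_left[OF bij g]
        by (intro bexI[of _ a]) (simp_all only: \<tau>_def)
    qed
    show "\<tau> (a \<otimes>\<^bsub>?F\<^esub> perm_action n (\<kappa> (\<tau> a)) b) = \<tau> a \<otimes>\<^bsub>K\<^esub> \<tau> b"
      if ab: "a \<in> carrier ?F" "b \<in> carrier ?F" for a b
    proof -
      have "\<phi> (a \<otimes>\<^bsub>?F\<^esub> perm_action n (\<kappa> (\<tau> a)) b) = \<kappa> (\<tau> a \<otimes>\<^bsub>K\<^esub> \<tau> b)"
        using \<phi>_cocycle[OF ab] ab 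
        by (simp add: \<kappa>_\<tau> \<kappa>_mult \<tau>_closed del: carrier_free_Abelian_group_iff)
      then have "\<tau> (a \<otimes>\<^bsub>?F\<^esub> perm_action n (\<kappa> (\<tau> a)) b) =
          inv_into (carrier K) \<kappa> (\<kappa> (\<tau> a \<otimes>\<^bsub>K\<^esub> \<tau> b))"
        by (simp only: \<tau>_def[of "_ \<otimes>\<^bsub>?F\<^esub> _"])
      also have "\<dots> = \<tau> a \<otimes>\<^bsub>K\<^esub> \<tau> b"
        using ab by (intro bij_betw_inv_into_left[OF bij] K.m_closed \<tau>_closed)
      finally show ?thesis .
    qed
    show "perm_action n (\<kappa> g) s \<in> insert 0 (frag_of ` {1..n})"
      if g: "g \<in> carrier K" and s: "s \<in> insert 0 (frag_of ` {1..n})" for g s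
    proof (cases "s = 0")
      case True
      then show ?thesis using perm.act_unit[OF \<kappa>_closed[OF g]] by simp
    next
      case False
      then obtain i where i: "i \<in> {1..n}" "s = frag_of i" using s by blast
      have "\<kappa> g i \<in> {1..n}"
        using \<kappa>_closed[OF g] i(1) permutes_in_image by (fastforce simp: sym_group_carrier)
      then show ?thesis using i by (simp only: perm_action_basis) blast
    qed
    show "carrier ?F \<subseteq> U" if "subgroup U ?F" "insert 0 (frag_of ` {1..n}) \<subseteq> U" for U
      using that by (intro subgroup_free_Abelian_group_eq) auto
  qed auto
  then show thesis by (rule that)
qed

section \<open>A finite group with a cocycle cover is IYB\<close>

text \<open>
  The action of \<open>G\<close> on \<open>S\<close> may have a kernel, so \<open>S\<close> is replaced by \<open>S \<times> G\<close>, where \<open>G\<close> acts on the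
  second factor by left translation and hence faithfully. After numbering \<open>S \<times> G\<close> by \<open>{1..n}\<close> the
  action becomes \<open>\<rho>\<close> and the projection to \<open>S\<close> becomes \<open>s\<close>.
\<close>

lemma (in cocycle_cover) obtain_faithful_permutation_cover:
  assumes "finite (carrier G)"
  obtains n s \<rho> where "n > 0" "s ` {1..n} = S"
    "\<rho> \<in> hom G (sym_group n)" "inj_on \<rho> (carrier G)"
    "\<And>g i. \<lbrakk>g \<in> carrier G; i \<in> {1..n}\<rbrakk> \<Longrightarrow> s (\<rho> g i) = \<alpha> g (s i)"
proof -
  define \<Omega> where "\<Omega> = S \<times> carrier G"
  define n where "n = card \<Omega>"
  have "finite \<Omega>" using assms gens_finite by (simp add: \<Omega>_def)
  have "(\<one>\<^bsub>C\<^esub>, \<one>\<^bsub>G\<^esub>) \<in> \<Omega>" using gens_one by (simp add: \<Omega>_def)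
  then have "n > 0"
    using \<open>finite \<Omega>\<close> by (auto simp: n_def card_gt_0_iff)
  obtain e where e: "bij_betw e {1..n} \<Omega>"
    using ex_bij_betw_nat_finite_1[OF \<open>finite \<Omega>\<close>] by (auto simp: n_def)
  define e' where "e' = inv_into {1..n} e"
  have e'_e: "e' (e i) = i" if "i \<in> {1..n}" for i
    using bij_betw_inv_into_left[OF e that] by (simp add: e'_def)
  have e_e': "e (e' x) = x" "e' x \<in> {1..n}" if "x \<in> \<Omega>" for x
    using bij_betw_inv_into_right[OF e that] bij_betwE[OF bij_betw_inv_into[OF e]] that
    by (auto simp: e'_def)
  have e_closed: "e i \<in> \<Omega>" if "i \<in> {1..n}" for i
    using bij_betwE[OF e] that by blast
  define L where "L g x = (\<alpha> g (fst x), g \<otimes>\<^bsub>G\<^esub> snd x)" for g x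
  have L_closed: "L g x \<in> \<Omega>" if "g \<in> carrier G" "x \<in> \<Omega>" for g x
    using that gens_stable by (auto simp: L_def \<Omega>_def)
  have L_comp: "L (g \<otimes>\<^bsub>G\<^esub> h) x = L g (L h x)" if "g \<in> carrier G" "h \<in> carrier G" "x \<in> \<Omega>" for g h x
    using that gens_carrier by (auto simp: L_def \<Omega>_def act_comp G.m_assoc)
  have L_one: "L \<one>\<^bsub>G\<^esub> x = x" if "x \<in> \<Omega>" for x
    using that gens_carrier by (auto simp: L_def \<Omega>_def act_one)
  define \<rho> where "\<rho> g i = (if i \<in> {1..n} then e' (L g (e i)) else i)" for g i
  have \<rho>_comp: "\<rho> (g \<otimes>\<^bsub>G\<^esub> h) = \<rho> g \<circ> \<rho> h" if "g \<in> carrier G" "h \<in> carrier G" for g h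
  proof
    fix i
    show "\<rho> (g \<otimes>\<^bsub>G\<^esub> h) i = (\<rho> g \<circ> \<rho> h) i"
      using that by (cases "i \<in> {1..n}") 
        (simp_all only: \<rho>_def e_closed e_e' L_closed L_comp comp_apply if_True if_False)
  qed
  have \<rho>_one: "\<rho> \<one>\<^bsub>G\<^esub> = id"
    by (auto simp: \<rho>_def L_one e_closed e'_e simp del: atLeastAtMost_iff)
  have \<rho>_permutes: "\<rho> g permutes {1..n}" if g: "g \<in> carrier G" for g
  proof (rule bij_imp_permutes)
    have inv: "\<rho> (inv\<^bsub>G\<^esub> g) \<circ> \<rho> g = id" "\<rho> g \<circ> \<rho> (inv\<^bsub>G\<^esub> g) = id"
      using g \<rho>_comp[of g "inv\<^bsub>G\<^esub> g"] \<rho>_comp[of "inv\<^bsub>G\<^esub> g" g] by (simp_all add: \<rho>_one)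
    have maps: "\<rho> h ` {1..n} \<subseteq> {1..n}" if "h \<in> carrier G" for h
      using that by (auto simp only: \<rho>_def if_True intro!: e_e'(2) L_closed e_closed)
    show "bij_betw (\<rho> g) {1..n} {1..n}"
      using inv maps g
      by (intro bij_betw_byWitness[where f' = "\<rho> (inv\<^bsub>G\<^esub> g)"]) 
        (auto simp: fun_eq_iff simp del: atLeastAtMost_iff)
    show "\<rho> g i = i" if "i \<notin> {1..n}" for i
      using that by (simp only: \<rho>_def if_False)
  qed
  have s_\<rho>: "fst (e (\<rho> g i)) = \<alpha> g (fst (e i))" if "g \<in> carrier G" "i \<in> {1..n}" for g i
  proof -
    have "e (\<rho> g i) = L g (e i)"
      using that by (simp add: \<rho>_def e_closed e_e' L_closed del: atLeastAtMost_iff)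
    then show ?thesis by (simp add: L_def)
  qed
  have inj: "inj_on \<rho> (carrier G)"
  proof (rule inj_onI)
    fix g h assume gh: "g \<in> carrier G" "h \<in> carrier G" "\<rho> g = \<rho> h"
    let ?x = "(\<one>\<^bsub>C\<^esub>, \<one>\<^bsub>G\<^esub>)"
    have x: "?x \<in> \<Omega>" by fact
    have "e (\<rho> k (e' ?x)) = L k ?x" if "k \<in> carrier G" for k
      using that x by (simp only: \<rho>_def e_e' L_closed if_True)
    from this[OF gh(1)] this[OF gh(2)] have "L g ?x = L h ?x"
      using gh(3) by simp
    then show "g = h" using gh by (simp add: L_def)
  qed
  have "(\<lambda>i. fst (e i)) ` {1..n} = fst ` \<Omega>"
    using bij_betw_imp_surj_on[OF e] by (auto simp: image_image[symmetric])
  also have "\<dots> = S"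
    using G.one_closed by (force simp: \<Omega>_def)
  finally show thesis
    using that[of n "\<lambda>i. fst (e i)" \<rho>] \<open>n > 0\<close> inj s_\<rho> \<rho>_permutes \<rho>_comp
    by (simp add: hom_def sym_group_carrier sym_group_mult)
qed

text \<open>
  Let \<open>h : Fa\<^sub>n \<rightarrow> C\<close> extend \<open>s\<close>. It is surjective because \<open>S\<close> generates \<open>C\<close>, and equivariant because
  it is so on the basis. Hence the cocycle identity of \<open>\<tau>\<close> lifts to \<open>\<psi> = \<tau> \<circ> h\<close>, and \<open>\<phi> = \<rho> \<circ> \<psi>\<close> has
  image \<open>\<rho>(G) \<cong> G\<close>.
\<close>

theorem (in cocycle_cover) IYB_group_of_cover:
  assumes "finite (carrier G)"
  shows "IYB_group G"
proof -
  obtain n s \<rho> where n: "n > 0" and s_image: "s ` {1..n} = S"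
    and \<rho>: "\<rho> \<in> hom G (sym_group n)" and inj: "inj_on \<rho> (carrier G)"
    and s_\<rho>: "\<And>g i. \<lbrakk>g \<in> carrier G; i \<in> {1..n}\<rbrakk> \<Longrightarrow> s (\<rho> g i) = \<alpha> g (s i)"
    using obtain_faithful_permutation_cover[OF assms] by metis
  let ?F = "free_Abelian_group {1..n}"
  let ?P = "semidirect_product ?F (sym_group n) (perm_action n)"
  interpret perm: automorphism_action "sym_group n" ?F "perm_action n"
    by (rule automorphism_action_perm_action)
  interpret P: group ?P
    using group_semidirect_product[OF _ sym_group_is_group perm_action_hom] by simp
  interpret \<rho>: group_hom G "sym_group n" \<rho>
    using \<rho> sym_group_is_group G.is_group by (simp add: group_hom_def group_hom_axioms_def)
  obtain h where h_hom: "h \<in> hom ?F C" and h_basis: "\<And>i. i \<in> {1..n} \<Longrightarrow> h (frag_of i) = s i"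
    using C.free_Abelian_group_universal[of s "{1..n}"] s_image gens_carrier by blast
  interpret h: group_hom ?F C h
    using h_hom C.is_group by (simp add: group_hom_def group_hom_axioms_def)
  have h_closed: "h a \<in> carrier C" if "a \<in> carrier ?F" for a
    using that by (rule h.hom_closed)
  have h_add: "h (a + b) = h a \<otimes>\<^bsub>C\<^esub> h b" if "a \<in> carrier ?F" "b \<in> carrier ?F" for a b
    using h.hom_mult[OF that] by simp
  have "h ` carrier ?F = carrier C"
  proof
    have "S \<subseteq> h ` carrier ?F"
      using h_basis unfolding s_image[symmetric]
      by (force simp: image_iff intro!: bexI[of _ "frag_of _"])
    then show "carrier C \<subseteq> h ` carrier ?F"
      by (rule gens_generate[OF h.img_is_subgroup])
  qed (use h_closed in blast)
  have equivariant: "h (perm_action n (\<rho> g) a) = \<alpha> g (h a)"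
    if g: "g \<in> carrier G" and a: "a \<in> carrier ?F" for g a
  proof -
    have \<rho>g: "\<rho> g \<in> carrier (sym_group n)" using g by simp
    interpret hp: group_hom ?F C "h \<circ> perm_action n (\<rho> g)"
      using hom_compose[OF perm.act_hom[OF \<rho>g] h_hom] C.is_group
      by (simp add: group_hom_def group_hom_axioms_def)
    interpret ah: group_hom ?F C "\<alpha> g \<circ> h"
      using hom_compose[OF h_hom act_hom[OF g]] C.is_group
      by (simp add: group_hom_def group_hom_axioms_def)
    let ?U = "{a \<in> carrier ?F. (h \<circ> perm_action n (\<rho> g)) a = (\<alpha> g \<circ> h) a}"
    have "subgroup ?U ?F"
    proof (rule perm.C.subgroupI)
      have "\<one>\<^bsub>?F\<^esub> \<in> ?U"
        using hp.hom_one ah.hom_one by simp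
      then show "?U \<noteq> {}" by blast
      show "inv\<^bsub>?F\<^esub> a \<in> ?U" if "a \<in> ?U" for a
        using that hp.hom_inv[of a] ah.hom_inv[of a] perm.C.inv_closed[of a]
        by (simp del: inv_free_Abelian_group carrier_free_Abelian_group_iff o_apply)
      show "a \<otimes>\<^bsub>?F\<^esub> b \<in> ?U" if "a \<in> ?U" "b \<in> ?U" for a b
        using that hp.hom_mult[of a b] ah.hom_mult[of a b] perm.C.m_closed[of a b]
        by (simp del: mult_free_Abelian_group carrier_free_Abelian_group_iff o_apply)
    qed blast
    moreover have "frag_of i \<in> ?U" if i: "i \<in> {1..n}" for i
    proof -
      have "\<rho> g i \<in> {1..n}"
        using \<rho>g i permutes_in_image by (fastforce simp: sym_group_carrier)
      then have "h (perm_action n (\<rho> g) (frag_of i)) = \<alpha> g (h (frag_of i))"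
        using i g by (simp only: perm_action_basis h_basis s_\<rho>)
      then show ?thesis using i by simp
    qed
    ultimately have "carrier ?F \<subseteq> ?U"
      by (intro subgroup_free_Abelian_group_eq) blast+
    then show ?thesis using a by (auto simp del: carrier_free_Abelian_group_iff)
  qed
  define \<psi> where "\<psi> a = \<tau> (h a)" for a
  have \<psi>_closed: "\<psi> a \<in> carrier G" if "a \<in> carrier ?F" for a
    using that h_closed cover_closed by (simp only: \<psi>_def)
  have \<psi>_image: "\<psi> ` carrier ?F = carrier G"
    using \<psi>_closed cover_surj \<open>h ` carrier ?F = carrier C\<close> unfolding \<psi>_def
    by (smt (verit, ccfv_threshold) image_iff subsetI subset_antisym)
  have \<psi>_zero: "\<psi> 0 = \<one>\<^bsub>G\<^esub>"
    using h.hom_one cover_one by (simp add: \<psi>_def)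
  have perm_closed: "perm_action n (\<rho> g) a \<in> carrier ?F"
    if "g \<in> carrier G" "a \<in> carrier ?F" for g a
    using that perm.act_closed \<rho>.hom_closed by blast
  have \<psi>_cocycle: "\<psi> (a + perm_action n (\<rho> (\<psi> a)) b) = \<psi> a \<otimes>\<^bsub>G\<^esub> \<psi> b"
    if ab: "a \<in> carrier ?F" "b \<in> carrier ?F" for a b
  proof -
    have "h (a + perm_action n (\<rho> (\<psi> a)) b) = h a \<otimes>\<^bsub>C\<^esub> \<alpha> (\<psi> a) (h b)"
      using ab \<psi>_closed perm_closed by (simp only: h_add equivariant)
    then show ?thesis
      using cover_cocycle ab h_closed by (simp only: \<psi>_def)
  qed
  define \<phi> where "\<phi> a = \<rho> (\<psi> a)" for a
  have \<phi>_closed: "\<phi> a \<in> carrier (sym_group n)" if "a \<in> carrier ?F" for a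
    using that \<psi>_closed \<rho>.hom_closed by (simp only: \<phi>_def)
  have \<phi>_zero: "\<phi> 0 = \<one>\<^bsub>sym_group n\<^esub>"
    by (simp add: \<phi>_def \<psi>_zero)
  have \<phi>_cocycle: "\<phi> (a + perm_action n (\<phi> a) b) = \<phi> a \<otimes>\<^bsub>sym_group n\<^esub> \<phi> b"
    if "a \<in> carrier ?F" "b \<in> carrier ?F" for a b
    using that \<psi>_closed \<psi>_cocycle \<rho>.hom_mult by (simp only: \<phi>_def)
  have \<phi>_image: "\<phi> ` carrier ?F = \<rho> ` carrier G"
    using \<psi>_image by (simp add: \<phi>_def image_image[symmetric])
  let ?\<Gamma> = "{(a, \<phi> a) | a. a \<in> carrier ?F}"
  have P_mult: "(a, \<phi> a) \<otimes>\<^bsub>?P\<^esub> (b, \<phi> b) =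
      (a + perm_action n (\<phi> a) b, \<phi> (a + perm_action n (\<phi> a) b))"
    if "a \<in> carrier ?F" "b \<in> carrier ?F" for a b
    using \<phi>_cocycle[OF that] by (simp add: semidirect_product_def)
  have sum_closed: "a + perm_action n (\<phi> a) b \<in> carrier ?F"
    if "a \<in> carrier ?F" "b \<in> carrier ?F" for a b
    using perm.C.m_closed[OF that(1) perm.act_closed[OF \<phi>_closed[OF that(1)] that(2)]] by simp
  have \<Gamma>_sub: "?\<Gamma> \<subseteq> carrier ?P"
    using \<phi>_closed by (auto simp: semidirect_product_def simp del: carrier_free_Abelian_group_iff)
  have "subgroup ?\<Gamma> ?P"
  proof (rule P.subgroupI)
    show "?\<Gamma> \<noteq> {}" using perm.C.one_closed by blast
    show "x \<otimes>\<^bsub>?P\<^esub> y \<in> ?\<Gamma>" if "x \<in> ?\<Gamma>" "y \<in> ?\<Gamma>" for x y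
    proof -
      obtain a b where "a \<in> carrier ?F" "b \<in> carrier ?F" "x = (a, \<phi> a)" "y = (b, \<phi> b)"
        using \<open>x \<in> ?\<Gamma>\<close> \<open>y \<in> ?\<Gamma>\<close> by blast
      then show ?thesis using P_mult sum_closed by blast
    qed
    show "inv\<^bsub>?P\<^esub> x \<in> ?\<Gamma>" if x_in: "x \<in> ?\<Gamma>" for x
    proof -
      obtain a where a: "a \<in> carrier ?F" and x: "x = (a, \<phi> a)" using x_in by blast
      \<comment> \<open>The first component of the inverse of \<open>(a, \<phi> a)\<close> in the semidirect product; the cocycle
        identity then forces \<open>\<phi> a \<phi> b = \<phi> 0 = \<one>\<close>.\<close>
      define b where "b = perm_action n (inv\<^bsub>sym_group n\<^esub> (\<phi> a)) (inv\<^bsub>?F\<^esub> a)"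
      have b: "b \<in> carrier ?F"
        unfolding b_def
        by (intro perm.act_closed perm.G.inv_closed perm.C.inv_closed \<phi>_closed a)
      have "perm_action n (\<phi> a) b = inv\<^bsub>?F\<^esub> a"
        unfolding b_def
        by (intro perm.act_inv_cancel perm.C.inv_closed \<phi>_closed a)
      then have "a + perm_action n (\<phi> a) b = 0"
        using perm.C.r_inv[OF a] by simp
      then have "x \<otimes>\<^bsub>?P\<^esub> (b, \<phi> b) = \<one>\<^bsub>?P\<^esub>"
        using P_mult[OF a b] x by (simp add: \<phi>_zero) (simp add: semidirect_product_def)
      moreover have "x \<in> carrier ?P" "(b, \<phi> b) \<in> carrier ?P"
        using \<Gamma>_sub b x_in by blast+
      ultimately have "inv\<^bsub>?P\<^esub> x = (b, \<phi> b)"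
        by (metis P.inv_comm P.inv_equality)
      then show ?thesis using b by blast
    qed
  qed fact
  moreover have "\<rho> \<in> iso G ((sym_group n)\<lparr>carrier := \<phi> ` carrier ?F\<rparr>)"
    unfolding \<phi>_image using inj \<rho>.hom_mult by (auto simp: iso_def hom_def bij_betw_def)
  ultimately show ?thesis
    unfolding IYB_group_def using assms G.is_group n \<phi>_closed
    by (blast intro: is_isoI)
qed

section \<open>Covers of semidirect products and of quotients\<close>

text \<open>
  Since \<open>N \<rtimes> H\<close> acts on \<open>N \<times> C\<close> through \<open>H\<close>, both sides of the cocycle identity for \<open>(x, c)\<close> and
  \<open>(y, d)\<close> are \<open>(x \<cdot> \<tau>(c)(y), \<tau>(c) \<tau>(d))\<close>: the first component is the multiplication rule of the
  semidirect product, the second is the identity for \<open>\<tau>\<close>.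
\<close>

lemma cocycle_cover_semidirect_product:
  assumes "cocycle_cover H C \<alpha> \<tau> S"
    and N: "comm_group N" "finite (carrier N)" and \<beta>: "\<beta> \<in> hom H (AutoGroup N)"
  shows "cocycle_cover (semidirect_product N H \<beta>) (N \<times>\<times> C)
    (\<lambda>(x, h) (y, c). (\<beta> h y, \<alpha> h c)) (\<lambda>(x, c). (x, \<tau> c)) (carrier N \<times> S)"
proof -
  interpret cover: cocycle_cover H C \<alpha> \<tau> S by fact
  interpret N: comm_group N by fact
  interpret \<beta>: automorphism_action H N \<beta>
    by (rule automorphism_action_of_hom) (use cover.G.is_group N \<beta> in auto)
  let ?P = "semidirect_product N H \<beta>"
  interpret P: group ?P
    by (rule group_semidirect_product) (use N.is_group cover.G.is_group \<beta> in auto)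
  interpret NC: group "N \<times>\<times> C"
    by (rule DirProd_group) (rule N.is_group cover.C.is_group)+
  show ?thesis
  proof
    show "x \<otimes>\<^bsub>N \<times>\<times> C\<^esub> y = y \<otimes>\<^bsub>N \<times>\<times> C\<^esub> x"
      if "x \<in> carrier (N \<times>\<times> C)" "y \<in> carrier (N \<times>\<times> C)" for x y
      using that by (auto simp: N.m_comm cover.C.m_comm)
    show "\<exists>c\<in>carrier (N \<times>\<times> C). (case c of (x, c) \<Rightarrow> (x, \<tau> c)) = p" if "p \<in> carrier ?P" for p
      using that cover.cover_surj by (force simp: semidirect_product_def)
    show "finite (carrier N \<times> S)"
      using N cover.gens_finite by simp
    show "carrier (N \<times>\<times> C) \<subseteq> U" if U: "subgroup U (N \<times>\<times> C)" and NS: "carrier N \<times> S \<subseteq> U" for U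
    proof -
      interpret U: subgroup U "N \<times>\<times> C" by fact
      let ?V = "{c \<in> carrier C. (\<one>\<^bsub>N\<^esub>, c) \<in> U}"
      have "subgroup ?V C"
      proof (rule cover.C.subgroupI)
        show "?V \<noteq> {}" using U.one_closed by auto
        show "inv\<^bsub>C\<^esub> c \<in> ?V" if "c \<in> ?V" for c
          using that U.m_inv_closed[of "(\<one>\<^bsub>N\<^esub>, c)"]
          by (simp add: inv_DirProd[OF N.is_group cover.C.is_group])
        show "c \<otimes>\<^bsub>C\<^esub> d \<in> ?V" if "c \<in> ?V" "d \<in> ?V" for c d
          using that U.m_closed[of "(\<one>\<^bsub>N\<^esub>, c)" "(\<one>\<^bsub>N\<^esub>, d)"] by simp
      qed blast
      moreover have "S \<subseteq> ?V"
        using NS cover.gens_carrier by auto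
      ultimately have V: "carrier C \<subseteq> ?V"
        by (rule cover.gens_generate)
      have "(x, c) \<in> U" if "x \<in> carrier N" "c \<in> carrier C" for x c
        using that NS V cover.gens_one U.m_closed[of "(x, \<one>\<^bsub>C\<^esub>)" "(\<one>\<^bsub>N\<^esub>, c)"] by auto
      then show ?thesis by auto
    qed
  qed (use cover.gens_carrier cover.gens_one in \<open>auto simp: semidirect_product_def \<beta>.act_closed
      \<beta>.act_mult \<beta>.act_comp \<beta>.act_one cover.act_closed cover.act_mult cover.act_comp cover.act_one
      cover.cover_closed cover.cover_cocycle cover.gens_stable\<close>)
qed

text \<open>
  As the kernel of \<open>\<theta>\<close> acts trivially, \<open>p\<close> acts on \<open>C\<close> in a way that depends only on \<open>\<theta> p\<close>. So \<open>G\<close>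
  acts on \<open>C\<close> through arbitrarily chosen preimages.
\<close>

lemma cocycle_cover_quotient:
  assumes "cocycle_cover P C \<alpha> \<tau> S" and "group G"
    and \<theta>: "\<theta> \<in> hom P G" "\<theta> ` carrier P = carrier G"
    and ker: "\<And>p c. \<lbrakk>p \<in> carrier P; \<theta> p = \<one>\<^bsub>G\<^esub>; c \<in> carrier C\<rbrakk> \<Longrightarrow> \<alpha> p c = c"
  shows "cocycle_cover G C (\<lambda>g. \<alpha> (inv_into (carrier P) \<theta> g)) (\<theta> \<circ> \<tau>) S"
proof -
  interpret cover: cocycle_cover P C \<alpha> \<tau> S by fact
  interpret G: group G by fact
  interpret \<theta>: group_hom P G \<theta>
    using \<theta>(1) cover.G.is_group G.is_group by (simp add: group_hom_def group_hom_axioms_def)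
  let ?l = "inv_into (carrier P) \<theta>"
  have l: "?l g \<in> carrier P" "\<theta> (?l g) = g" if "g \<in> carrier G" for g
    using that \<theta>(2) by (auto intro: inv_into_into f_inv_into_f)
  have eq: "\<alpha> p c = \<alpha> q c"
    if pq: "p \<in> carrier P" "q \<in> carrier P" "\<theta> p = \<theta> q" and c: "c \<in> carrier C" for p q c
  proof -
    have "\<alpha> (inv\<^bsub>P\<^esub> q \<otimes>\<^bsub>P\<^esub> p) c = c"
      using pq c by (intro ker) auto
    then have "\<alpha> q (\<alpha> (inv\<^bsub>P\<^esub> q) (\<alpha> p c)) = \<alpha> q c"
      using pq c by (simp add: cover.act_comp)
    then show ?thesis
      using pq c by (simp add: cover.act_inv_cancel cover.act_closed)
  qed
  have l_\<theta>: "\<alpha> (?l (\<theta> p)) c = \<alpha> p c" if "p \<in> carrier P" "c \<in> carrier C" for p c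
    using that l by (intro eq) auto
  show ?thesis
  proof
    show "\<alpha> (?l (g \<otimes>\<^bsub>G\<^esub> h)) c = \<alpha> (?l g) (\<alpha> (?l h) c)"
      if "g \<in> carrier G" "h \<in> carrier G" "c \<in> carrier C" for g h c
    proof -
      have "\<alpha> (?l (g \<otimes>\<^bsub>G\<^esub> h)) c = \<alpha> (?l g \<otimes>\<^bsub>P\<^esub> ?l h) c"
        using that l by (intro eq) auto
      then show ?thesis using that l by (simp add: cover.act_comp)
    qed
    show "\<alpha> (?l \<one>\<^bsub>G\<^esub>) c = c" if "c \<in> carrier C" for c
      using that l by (intro ker) auto
    show "\<exists>c\<in>carrier C. (\<theta> \<circ> \<tau>) c = g" if "g \<in> carrier G" for g
      using that l cover.cover_surj by (metis comp_apply)
    show "(\<theta> \<circ> \<tau>) (c \<otimes>\<^bsub>C\<^esub> \<alpha> (?l ((\<theta> \<circ> \<tau>) c)) d) = (\<theta> \<circ> \<tau>) c \<otimes>\<^bsub>G\<^esub> (\<theta> \<circ> \<tau>) d"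
      if "c \<in> carrier C" "d \<in> carrier C" for c d
      using that by (simp add: l_\<theta> cover.cover_closed cover.cover_cocycle)
    show "carrier C \<subseteq> U" if "subgroup U C" "S \<subseteq> U" for U
      using that by (rule cover.gens_generate)
  qed (use cover.gens_carrier in \<open>auto simp: l cover.act_closed cover.act_mult cover.cover_closed
      cover.gens_finite cover.gens_one cover.gens_stable\<close>)
qed

section \<open>Extensions by an abelian normal subgroup\<close>

lemma IYB_group_semidirect_product:
  assumes N: "comm_group N" "finite (carrier N)" and K: "IYB_group K"
    and \<beta>: "\<beta> \<in> hom K (AutoGroup N)"
  shows "IYB_group (semidirect_product N K \<beta>)"
proof -
  obtain n \<alpha> \<tau> S where "cocycle_cover K (free_Abelian_group {1..n::nat}) \<alpha> \<tau> S"
    using K by (rule IYB_group_obtains_cocycle_cover)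
  moreover have "finite (carrier (semidirect_product N K \<beta>))"
    using N K by (simp add: semidirect_product_def IYB_group_def)
  ultimately show ?thesis
    using cocycle_cover.IYB_group_of_cover cocycle_cover_semidirect_product N \<beta> by blast
qed

lemma IYB_group_of_abelian_normal_supplement:
  assumes "group G" and fin: "finite (carrier G)"
    and "A \<lhd> G" and A: "comm_group (G\<lparr>carrier := A\<rparr>)"
    and "subgroup H G" and AH: "carrier G = A <#>\<^bsub>G\<^esub> H"
    and B: "comm_group B" and \<alpha>: "\<alpha> \<in> hom (G\<lparr>carrier := H\<rparr>) (AutoGroup B)"
    and \<pi>: "bijective_1_cocycle (G\<lparr>carrier := H\<rparr>) B \<alpha> \<pi>"
    and trivial: "\<And>h b. \<lbrakk>h \<in> H \<inter> A; b \<in> carrier B\<rbrakk> \<Longrightarrow> \<alpha> h b = b"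
  shows "IYB_group G"
proof -
  interpret G: group G by fact
  interpret A: normal A G by fact
  interpret H: subgroup H G by fact
  let ?A = "G\<lparr>carrier := A\<rparr>" and ?H = "G\<lparr>carrier := H\<rparr>"
  interpret CA: comm_group ?A by fact
  have H_group: "group ?H" using H.subgroup_is_group[OF G.is_group] .
  have A_comm: "x \<otimes>\<^bsub>G\<^esub> y = y \<otimes>\<^bsub>G\<^esub> x" if "x \<in> A" "y \<in> A" for x y
    using CA.m_comm that by simp
  have inv_cancel: "inv\<^bsub>G\<^esub> x \<otimes>\<^bsub>G\<^esub> (x \<otimes>\<^bsub>G\<^esub> y) = y" if "x \<in> carrier G" "y \<in> carrier G" for x y
    using that by (simp flip: G.m_assoc)
  let ?conj = "\<lambda>h x. h \<otimes>\<^bsub>G\<^esub> x \<otimes>\<^bsub>G\<^esub> inv\<^bsub>G\<^esub> h"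
  interpret conj: automorphism_action ?H ?A ?conj
  proof (rule automorphism_action.intro[OF H_group A], unfold_locales)
    show "?conj h x \<in> carrier ?A" if "h \<in> carrier ?H" "x \<in> carrier ?A" for h x
      using that A.inv_op_closed2 by simp
    show "?conj h (x \<otimes>\<^bsub>?A\<^esub> y) = ?conj h x \<otimes>\<^bsub>?A\<^esub> ?conj h y"
      if "h \<in> carrier ?H" "x \<in> carrier ?A" "y \<in> carrier ?A" for h x y
      using that by (simp add: G.m_assoc inv_cancel)
    show "?conj (g \<otimes>\<^bsub>?H\<^esub> h) x = ?conj g (?conj h x)"
      if "g \<in> carrier ?H" "h \<in> carrier ?H" "x \<in> carrier ?A" for g h x
      using that by (simp add: G.m_assoc G.inv_mult_group)
    show "?conj \<one>\<^bsub>?H\<^esub> x = x" if "x \<in> carrier ?A" for x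
      using that by simp
  qed
  let ?\<beta> = "\<lambda>h. restrict (?conj h) (carrier ?A)"
  let ?P = "semidirect_product ?A ?H ?\<beta>"
  have "finite (carrier ?H)" "finite (carrier ?A)"
    using fin A.subset H.subset by (auto intro: finite_subset)
  then have cover: "cocycle_cover ?P (?A \<times>\<times> B) (\<lambda>(x, h) (y, b). (?\<beta> h y, \<alpha> h b))
      (\<lambda>(x, b). (x, inv_into (carrier ?H) \<pi> b)) (carrier ?A \<times> carrier B)"
    using cocycle_cover_semidirect_product[OF
        cocycle_cover_of_bijective_1_cocycle[OF H_group _ B \<alpha> \<pi>] A _ conj.restrict_act_hom_AutoGroup]
    by blast
  let ?\<theta> = "\<lambda>(x, h). x \<otimes>\<^bsub>G\<^esub> h"
  have \<theta>_hom: "?\<theta> \<in> hom ?P G"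
  proof (rule homI)
    fix p assume "p \<in> carrier ?P"
    then show "?\<theta> p \<in> carrier G" by (auto simp: semidirect_product_def)
  next
    fix p q assume "p \<in> carrier ?P" "q \<in> carrier ?P"
    then show "?\<theta> (p \<otimes>\<^bsub>?P\<^esub> q) = ?\<theta> p \<otimes>\<^bsub>G\<^esub> ?\<theta> q"
      by (auto simp: semidirect_product_def G.m_assoc inv_cancel)
  qed
  have \<theta>_image: "?\<theta> ` carrier ?P = carrier G"
    unfolding AH set_mult_def by (force simp: semidirect_product_def)
  \<comment> \<open>The kernel of multiplication \<open>A \<rtimes> H \<rightarrow> G\<close> acts trivially on \<open>A \<times> B\<close>.\<close>
  have "(case p of (x, h) \<Rightarrow> \<lambda>(y, b). (?\<beta> h y, \<alpha> h b)) c = c"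
    if p: "p \<in> carrier ?P" "?\<theta> p = \<one>\<^bsub>G\<^esub>" and c: "c \<in> carrier (?A \<times>\<times> B)" for p c
  proof -
    obtain x h where xh: "p = (x, h)" "x \<in> A" "h \<in> H" "x \<otimes>\<^bsub>G\<^esub> h = \<one>\<^bsub>G\<^esub>"
      using p by (auto simp: semidirect_product_def)
    obtain y b where yb: "c = (y, b)" "y \<in> A" "b \<in> carrier B"
      using c by auto
    have "h = inv\<^bsub>G\<^esub> x"
      using xh by (metis A.mem_carrier G.inv_equality G.inv_comm H.mem_carrier)
    then have "h \<in> A" using xh by simp
    then have "?conj h y = y"
      using yb A_comm[of h y] by (simp add: G.m_assoc)
    then show ?thesis
      using yb xh \<open>h \<in> A\<close> trivial by simp
  qed
  then have "cocycle_cover G (?A \<times>\<times> B)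
      (\<lambda>g. case inv_into (carrier ?P) ?\<theta> g of (x, h) \<Rightarrow> \<lambda>(y, b). (?\<beta> h y, \<alpha> h b))
      (?\<theta> \<circ> (\<lambda>(x, b). (x, inv_into (carrier ?H) \<pi> b))) (carrier ?A \<times> carrier B)"
    by (rule cocycle_cover_quotient[OF cover G.is_group \<theta>_hom \<theta>_image])
  then show ?thesis
    using fin by (rule cocycle_cover.IYB_group_of_cover)
qed

theorem theorem3p3:
  fixes G :: "('g, 'x) monoid_scheme" and A H :: "'g set"
    and B :: "('b, 'y) monoid_scheme" and \<alpha> :: "'g \<Rightarrow> 'b \<Rightarrow> 'b" and \<pi> :: "'g \<Rightarrow> 'b"
    and N :: "('n, 'z) monoid_scheme" and K :: "('k, 'w) monoid_scheme"
    and \<beta> :: "'k \<Rightarrow> 'n \<Rightarrow> 'n"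
  shows "(group G \<and> finite (carrier G) \<and>
          A \<lhd> G \<and> comm_group (G\<lparr>carrier := A\<rparr>) \<and>
          subgroup H G \<and> IYB_group (G\<lparr>carrier := H\<rparr>) \<and>
          carrier G = A <#>\<^bsub>G\<^esub> H \<and>
          comm_group B \<and> \<alpha> \<in> hom (G\<lparr>carrier := H\<rparr>) (AutoGroup B) \<and>
          bijective_1_cocycle (G\<lparr>carrier := H\<rparr>) B \<alpha> \<pi> \<and>
          (\<forall>h \<in> H \<inter> A. \<forall>b \<in> carrier B. \<alpha> h b = b)
          \<longrightarrow> IYB_group G)
       \<and> (comm_group N \<and> finite (carrier N) \<and> IYB_group K \<and> \<beta> \<in> hom K (AutoGroup N)
          \<longrightarrow> IYB_group (semidirect_product N K \<beta>))"
  by (blast intro: IYB_group_of_abelian_normal_supplement IYB_group_semidirect_product)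

end
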